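(* For $n\geq 1$, let $$Q_n^{(2)}(z) = \sum_{k=n-1}^{3n-3}e_n(k)z^k.$$ Then $e_n(k)$ is the number of restricted colored base-$3$ partitions of $\frac{1}{2}(3^n-3)$ having a total of $k$ parts. Furthermore, for these partitions of $\frac{1}{2}(3^n-3)$: (a) the number of parts lies between $n-1$ and $3n-3$; (b) the number of parts cannot have the same parity as $n$; (c) for $0\leq j\leq\lfloor(n-1)/2\rfloor$, there are as many partitions with $n-1+j$ parts as there are with $3n-3-j$ parts; (d) there are $3^{n-1}$ partitions with $n-1$ parts.
   Context: Let $Z=(w,x,y,z)$ be a quadruple of variables. The polynomials $S(n;Z)$, $n\ge 0$, are defined by the generating function $$\sum_{n=0}^{\infty}S(n;Z)q^n = \prod_{j=0}^{\infty}\left(1+wq^{3^j}\right)\left(1+xq^{3^j}\right)\left(1+yq^{3^j}+zq^{2\cdot 3^j}\right).$$ Define $Q_n(Z):=S(\tfrac{3^n-3}{2};Z)$ for $n\geq 1$, and $Q_n^{(2)}(z):=Q_n(z,z,z,z^2)$. A restricted colored base-$3$ partition of an integer $m\geq 0$ is a way of writing $m$ as a sum of powers of $3$ (with $3^0=1$ allowed; the order of the summands is irrelevant), where each part is either overlined, marked by a tilde, or unmarked (no part carries both marks), such that for every power $3^j$: at most one copy of $3^j$ is overlined, at most one copy of $3^j$ is marked by a tilde, and at most two copies of $3^j$ are unmarked. The integer $0$ has exactly one such partition, the empty one (with $0$ parts). Parts are counted with multiplicity. *)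

theory Defs
  imports
    "HOL-Analysis.Analysis"
    "HOL-Library.Multiset"
    "HOL-Computational_Algebra.Polynomial"
    "HOL-Computational_Algebra.Formal_Power_Series"
begin

text \<open>
  The library has no ready-made type of polynomials in the four variables \<open>w, x, y, z\<close>, so the
  polynomial \<open>S(n; w, x, y, z)\<close> is rendered by its values: \<open>w, x, y, z\<close> range over the elements
  of an arbitrary commutative ring (in particular, they may be polynomial indeterminates).
  The infinite product is taken in the metric topology of \<^typ>\<open>'a fps\<close>, in which convergence
  means that each coefficient is eventually constant.
\<close>

definition S_factor :: "'a::comm_ring_1 \<Rightarrow> 'a \<Rightarrow> 'a \<Rightarrow> 'a \<Rightarrow> nat \<Rightarrow> 'a fps" where
  "S_factor w x y z j =
     (1 + fps_const w * fps_X ^ (3 ^ j)) *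
     (1 + fps_const x * fps_X ^ (3 ^ j)) *
     (1 + fps_const y * fps_X ^ (3 ^ j) + fps_const z * fps_X ^ (2 * 3 ^ j))"

definition S_poly :: "nat \<Rightarrow> 'a::comm_ring_1 \<Rightarrow> 'a \<Rightarrow> 'a \<Rightarrow> 'a \<Rightarrow> 'a" where
  "S_poly n w x y z = fps_nth (\<Prod>j. S_factor w x y z j) n"

definition Q_poly :: "nat \<Rightarrow> 'a::comm_ring_1 \<Rightarrow> 'a \<Rightarrow> 'a \<Rightarrow> 'a \<Rightarrow> 'a" where
  "Q_poly n w x y z = S_poly ((3 ^ n - 3) div 2) w x y z"

text \<open>Here \<open>[:0, 1:]\<close> is the indeterminate of \<open>\<int>[z]\<close>.\<close>

definition Q2_poly :: "nat \<Rightarrow> int poly" where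
  "Q2_poly n = Q_poly n [:0, 1:] [:0, 1:] [:0, 1:] ([:0, 1:]\<^sup>2)"

definition e_coeff :: "nat \<Rightarrow> nat \<Rightarrow> int" where
  "e_coeff n k = coeff (Q2_poly n) k"

datatype mark = Unmarked | Overlined | Tilde

text \<open>
  A colored partition is a multiset of pairs (part, mark); its number of parts, counted with
  multiplicity, is the \<^const>\<open>size\<close> of the multiset.
\<close>

definition restricted_colored_partition :: "nat \<Rightarrow> (nat \<times> mark) multiset \<Rightarrow> bool" where
  "restricted_colored_partition m P \<longleftrightarrow>
     (\<forall>(p, c) \<in># P. \<exists>j. p = 3 ^ j) \<and>
     (\<Sum>(p, c) \<in># P. p) = m \<and>
     (\<forall>j. count P (3 ^ j, Overlined) \<le> 1 \<and>
          count P (3 ^ j, Tilde) \<le> 1 \<and>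
          count P (3 ^ j, Unmarked) \<le> 2)"

text \<open>The defining product converges, and finitely many factors determine each coefficient.\<close>

lemma fps_nth_mult_S_factor:
  assumes "k < 3 ^ j"
  shows "fps_nth (f * S_factor w x y z j) k = fps_nth f k"
proof -
  let ?X = "fps_X ^ (3 ^ j) :: 'a fps"
  have "S_factor w x y z j = 1 + ?X * (fps_const w + (1 + fps_const w * ?X) * fps_const x
      + (1 + fps_const w * ?X) * (1 + fps_const x * ?X) * (fps_const y + fps_const z * ?X))"
    unfolding S_factor_def by (simp add: algebra_simps mult_2 power_add)
  then obtain g where g: "S_factor w x y z j = 1 + ?X * g" by blast
  have "f * S_factor w x y z j = f + ?X * (f * g)"
    unfolding g by (simp add: algebra_simps)
  then show ?thesis using assms by (simp add: fps_X_power_mult_nth)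
qed

lemma fps_nth_prod_S_factor:
  assumes "k \<le> N"
  shows "fps_nth (\<Prod>j\<le>N. S_factor w x y z j) k = fps_nth (\<Prod>j\<le>k. S_factor w x y z j) k"
  using assms
proof (induction N rule: dec_induct)
  case (step N)
  have "N < 3 ^ N" for N :: nat by (induction N) auto
  from this[of "Suc N"] step(1) have "k < 3 ^ Suc N" by linarith
  then show ?case using step by (simp add: fps_nth_mult_S_factor del: power_Suc)
qed simp

lemma S_factor_has_prod:
  "S_factor w x y z has_prod Abs_fps (\<lambda>k. fps_nth (\<Prod>j\<le>k. S_factor w x y z j) k)"
    (is "_ has_prod ?L")
proof -
  have "(\<lambda>N. \<Prod>j\<le>N. S_factor w x y z j) \<longlonglongrightarrow> ?L"
    unfolding tendsto_fps_iff
    by (auto simp: eventually_at_top_linorder intro: fps_nth_prod_S_factor)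
  moreover have "fps_nth ?L 0 = 1"
    using fps_nth_mult_S_factor[of 0 0 1 w x y z] by simp
  then have "?L \<noteq> 0" by (metis fps_zero_nth zero_neq_one)
  ultimately show ?thesis by (simp add: has_prod_def raw_has_prod_def)
qed

lemma S_poly_eq: "S_poly n w x y z = fps_nth (\<Prod>j\<le>n. S_factor w x y z j) n"
proof -
  have nz: "S_factor w x y z j \<noteq> 0" for j
    using fps_nth_mult_S_factor[of 0 j 1 w x y z] by auto
  have "prodinf (S_factor w x y z) = Abs_fps (\<lambda>k. fps_nth (\<Prod>j\<le>k. S_factor w x y z j) k)"
    unfolding prodinf_def
    using S_factor_has_prod[of w x y z]
    by (intro the_equality) (auto simp: has_prod_def raw_has_prod_def nz intro: LIMSEQ_unique)
  then show ?thesis by (simp add: S_poly_def)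
qed

lemma finite_restricted_colored_partitions: "finite {P. restricted_colored_partition m P}"
proof -
  have mark: "(UNIV :: mark set) = {Unmarked, Overlined, Tilde}" using mark.exhaust by auto
  let ?A = "{0..m} \<times> (UNIV :: mark set)"
  have bound: "set_mset P \<subseteq> {0..\<Sum>(p, c) \<in># P. p} \<times> UNIV \<and> size P \<le> (\<Sum>(p, c) \<in># P. p)"
    if "\<forall>(p, c) \<in># P. \<exists>j. p = 3 ^ j" for P :: "(nat \<times> mark) multiset"
    using that
  proof (induction P)
    case (add a P)
    obtain p c where "a = (p, c)" "1 \<le> p" using add.prems by (cases a) auto
    moreover have "set_mset P \<subseteq> {0..\<Sum>(p, c) \<in># P. p} \<times> UNIV \<and> size P \<le> (\<Sum>(p, c) \<in># P. p)"
      using add by simp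
    ultimately show ?case by (auto simp: subset_iff intro: trans_le_add2)
  qed auto
  have "{P. restricted_colored_partition m P} \<subseteq> (\<Union>k\<le>m. multisets_of_size ?A k)"
    using bound
    unfolding restricted_colored_partition_def multisets_of_size_def by auto
  moreover have "finite \<dots>"
    by (intro finite_UN_I finite_multisets_of_size) (auto simp: mark)
  ultimately show ?thesis by (rule finite_subset)
qed

end

theory Submission
  imports Defs "HOL-Computational_Algebra.Formal_Laurent_Series"
begin

text \<open>
  The generating product \<open>F(q)\<close> satisfies \<open>F(q) = G(q) F(q\<^sup>3)\<close>, where \<open>G\<close> is its factor for \<open>j = 0\<close>,
  a polynomial of degree 4 in \<open>q\<close>. Hence \<open>S(3n + r)\<close> is a combination of \<open>S(n)\<close> and \<open>S(n - 1)\<close>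
  only. The numbers \<open>m\<^sub>n = (3\<^sup>n - 3) / 2\<close> satisfy \<open>m\<^sub>n\<^sub>+\<^sub>1 = 3 (m\<^sub>n + 1)\<close>, so the pair
  \<open>(S(m\<^sub>n + 1), S(m\<^sub>n))\<close> determines its successor by a fixed linear map. The characteristic
  polynomial of that map gives a two-term recurrence for \<open>Q\<^sub>n\<close> (\<open>Q_poly_recurrence\<close>), which at
  \<open>w = x = y\<close> and with the fourth variable equal to \<open>z\<^sup>2\<close> becomes
  \<open>Q\<^sub>n\<^sub>+\<^sub>2 = 3 (z + z\<^sup>3) Q\<^sub>n\<^sub>+\<^sub>1 - 8 z\<^sup>4 Q\<^sub>n\<close>. Starting from \<open>Q\<^sub>1 = 1\<close> and \<open>Q\<^sub>2 = 3z + 3z\<^sup>3\<close>, induction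
  on this recurrence shows the range and parity of the exponents (\<open>e_coeff_support\<close>), the lowest
  coefficient (\<open>e_coeff_lowest\<close>) and the symmetry of \<open>Q\<^sub>n\<close> about the exponent \<open>2n - 2\<close>
  (\<open>e_coeff_symmetric\<close>). The symmetry persists because \<open>z + z\<^sup>3\<close> is symmetric about the exponent 2
  and \<open>z\<^sup>4\<close> about 4, so that both products are symmetric about \<open>2n + 2\<close>.

  It remains to read \<open>e\<^sub>n(k)\<close> as a number of partitions. At these values of the variables the
  \<open>j\<close>-th factor is \<open>(1 + u)\<^sup>2 (1 + u + u\<^sup>2)\<close> with \<open>u = z q\<^sup>t\<close>, \<open>t = 3\<^sup>j\<close>: one factor for each of the three
  marks, whose terms record the multiplicity of the part \<open>3\<^sup>j\<close> with that mark. A restricted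
  partition is exactly a multiset of marked parts with these bounds on multiplicities, so the
  product rule for such multisets (\<open>sum_bounded_multisets\<close>) gives \<open>S_poly_eq_sum_partitions\<close> and
  thus \<open>e_coeff_eq_card\<close>. The properties of the coefficients then become properties of the
  partitions: a partition with \<open>k\<close> parts exists just when \<open>e\<^sub>n(k) \<noteq> 0\<close>.
\<close>

section \<open>Recurrences from self-similarity of the product\<close>

lemma fps_nth_compose_X_cubed:
  "fps_nth (f oo fps_X ^ 3) n = (if 3 dvd n then fps_nth f (n div 3) else (0 :: 'a :: idom))"
  by (simp add: fps_nth_compose_X_power)

lemma S_factor_Suc:
  fixes w x y z :: "'a :: idom"
  shows "S_factor w x y z (Suc j) = S_factor w x y z j oo fps_X ^ 3"
proof -
  have X: "fps_X ^ k oo (fps_X ^ 3 :: 'a fps) = fps_X ^ (3 * k)" for k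
    by (simp add: fps_compose_power [symmetric] power_mult)
  show ?thesis
    unfolding S_factor_def
    by (simp add: fps_compose_mult_distrib fps_compose_add_distrib X mult.left_commute)
qed

text \<open>
  The identity \<open>F(q) = G(q) F(q\<^sup>3)\<close>, stated for truncations of the product: these determine all
  coefficients, and composition distributes over finite products.
\<close>

lemma prod_S_factor_Suc:
  fixes w x y z :: "'a :: idom"
  shows "(\<Prod>j\<le>Suc N. S_factor w x y z j) =
    S_factor w x y z 0 * ((\<Prod>j\<le>N. S_factor w x y z j) oo fps_X ^ 3)"
  by (simp add: prod.atMost_Suc_shift fps_compose_prod_distrib S_factor_Suc del: prod.atMost_Suc)

lemma S_poly_eq_truncation:
  assumes "n \<le> N"
  shows "S_poly n w x y z = fps_nth (\<Prod>j\<le>N. S_factor w x y z j) n"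
  by (simp add: S_poly_eq fps_nth_prod_S_factor[OF assms])

lemma S_factor_0_expand:
  "S_factor w x y z 0 =
     1 + fps_const (w + x + y) * fps_X + fps_const (w * x + (w + x) * y + z) * fps_X ^ 2
       + fps_const ((w + x) * z + w * x * y) * fps_X ^ 3 + fps_const (w * x * z) * fps_X ^ 4"
proof -
  have "(1 + a * X) * (1 + b * X) * (1 + c * X + d * X ^ 2) =
      1 + (a + b + c) * X + (a * b + (a + b) * c + d) * X ^ 2
        + ((a + b) * d + a * b * c) * X ^ 3 + (a * b * d) * X ^ 4" for a b c d X :: "'a fps"
    by (simp add: algebra_simps power2_eq_square power3_eq_cube power4_eq_xxxx)
  then show ?thesis
    by (simp add: S_factor_def flip: fps_const_add fps_const_mult)
qed

lemma fps_nth_S_factor_0_mult: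
  "fps_nth (S_factor w x y z 0 * f) n =
     fps_nth f n + (w + x + y) * (if n < 1 then 0 else fps_nth f (n - 1))
       + (w * x + (w + x) * y + z) * (if n < 2 then 0 else fps_nth f (n - 2))
       + ((w + x) * z + w * x * y) * (if n < 3 then 0 else fps_nth f (n - 3))
       + (w * x * z) * (if n < 4 then 0 else fps_nth f (n - 4))"
  using fps_X_power_mult_nth[of 1 f n]
  by (simp add: S_factor_0_expand distrib_right mult.assoc fps_X_power_mult_nth
      del: fps_const_add fps_const_mult)

text \<open>
  Only the terms of \<open>G(q)\<close> with exponent divisible by 3, namely 0 and 3, contribute to a coefficient
  of \<open>G(q) F(q\<^sup>3)\<close> at a multiple of 3.
\<close>

lemma S_poly_digit_0:
  fixes w x y z :: "'a :: idom"
  shows "S_poly (3 * Suc n) w x y z =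
    S_poly (Suc n) w x y z + ((w + x) * z + w * x * y) * S_poly n w x y z"
proof -
  define N where "N = 3 * Suc n"
  have trunc: "S_poly (3 * Suc n) w x y z = fps_nth (\<Prod>j\<le>Suc N. S_factor w x y z j) (3 * Suc n)"
    "S_poly (Suc n) w x y z = fps_nth (\<Prod>j\<le>N. S_factor w x y z j) (Suc n)"
    "S_poly n w x y z = fps_nth (\<Prod>j\<le>N. S_factor w x y z j) n"
    by (intro S_poly_eq_truncation; simp add: N_def)+
  have "\<not> 3 dvd 3 * Suc n - 1" "\<not> 3 dvd 3 * Suc n - 2" "\<not> 3 dvd 3 * Suc n - 4 \<or> 3 * Suc n < 4"
    by presburger+
  then show ?thesis
    unfolding trunc prod_S_factor_Suc fps_nth_S_factor_0_mult fps_nth_compose_X_cubed by auto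
qed

text \<open>
  Here the contributing exponents of \<open>G(q)\<close> are 1 and 4.
\<close>

lemma S_poly_digit_1:
  fixes w x y z :: "'a :: idom"
  shows "S_poly (3 * Suc n + 1) w x y z =
    (w + x + y) * S_poly (Suc n) w x y z + w * x * z * S_poly n w x y z"
proof -
  define N where "N = 3 * Suc n"
  have trunc: "S_poly (3 * Suc n + 1) w x y z = fps_nth (\<Prod>j\<le>Suc N. S_factor w x y z j) (3 * Suc n + 1)"
    "S_poly (Suc n) w x y z = fps_nth (\<Prod>j\<le>N. S_factor w x y z j) (Suc n)"
    "S_poly n w x y z = fps_nth (\<Prod>j\<le>N. S_factor w x y z j) n"
    by (intro S_poly_eq_truncation; simp add: N_def)+
  have "\<not> 3 dvd 3 * Suc n + 1" "\<not> 3 dvd 3 * Suc n + 1 - 2" "\<not> 3 dvd 3 * Suc n + 1 - 3"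
    by presburger+
  then show ?thesis
    unfolding trunc prod_S_factor_Suc fps_nth_S_factor_0_mult fps_nth_compose_X_cubed by auto
qed

lemma half_power_three_Suc:
  assumes "n \<ge> 1"
  shows "(3 ^ Suc n - 3) div 2 = 3 * Suc ((3 ^ n - 3) div 2 :: nat)"
proof -
  have "odd (3 ^ n :: nat)" "(3::nat) ^ n \<ge> 3"
    using assms power_increasing[of 1 n "3::nat"] by auto
  then show ?thesis unfolding power_Suc by presburger
qed

text \<open>
  With \<open>d = w + x + y\<close>, the step from \<open>(S(m\<^sub>n + 1), S(m\<^sub>n))\<close> to \<open>(S(m\<^sub>n\<^sub>+\<^sub>1 + 1), S(m\<^sub>n\<^sub>+\<^sub>1))\<close> is the linear
  map with rows \<open>(d, wxz)\<close> and \<open>(1, c)\<close>. The recurrence has its trace and its negated determinant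
  as coefficients; the proof eliminates the first component.
\<close>

lemma Q_poly_recurrence:
  fixes w x y z :: "'a :: idom"
  assumes "n \<ge> 1"
  defines "c \<equiv> (w + x) * z + w * x * y"
  shows "Q_poly (n + 2) w x y z =
    (w + x + y + c) * Q_poly (n + 1) w x y z + (w * x * z - (w + x + y) * c) * Q_poly n w x y z"
proof -
  define m where "m = (3 ^ n - 3 :: nat) div 2"
  have 1: "(3 ^ Suc n - 3) div 2 = 3 * Suc m"
    unfolding m_def using half_power_three_Suc[OF assms(1)] .
  have 2: "(3 ^ Suc (Suc n) - 3) div 2 = 3 * Suc (3 * Suc m)"
    using half_power_three_Suc[of "Suc n"] 1 by simp
  have "Q_poly (n + 2) w x y z = S_poly (3 * Suc m + 1) w x y z + c * Q_poly (n + 1) w x y z"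
    using 1 2 S_poly_digit_0[of "3 * Suc m" w x y z] by (simp add: Q_poly_def c_def)
  moreover have "S_poly (3 * Suc m + 1) w x y z =
      (w + x + y) * S_poly (Suc m) w x y z + w * x * z * Q_poly n w x y z"
    unfolding S_poly_digit_1 by (simp add: Q_poly_def m_def)
  moreover have "Q_poly (n + 1) w x y z = S_poly (Suc m) w x y z + c * Q_poly n w x y z"
    using 1 S_poly_digit_0[of m w x y z] by (simp add: Q_poly_def c_def m_def)
  ultimately show ?thesis by (simp add: algebra_simps)
qed

section \<open>Coefficients of the specialised polynomials\<close>

lemma Q2_poly_recurrence:
  assumes "n \<ge> 1"
  shows "Q2_poly (n + 2) =
    monom 3 1 * Q2_poly (n + 1) + monom 3 3 * Q2_poly (n + 1) - monom 8 4 * Q2_poly n"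
proof -
  let ?Z = "[:0, 1:] :: int poly"
  have m: "monom a k = of_int a * ?Z ^ k" for a k
    by (simp add: monom_altdef of_int_poly)
  have "Q2_poly (n + 2) = (3 * ?Z + 3 * ?Z ^ 3) * Q2_poly (n + 1) - 8 * ?Z ^ 4 * Q2_poly n"
    unfolding Q2_poly_def Q_poly_recurrence[OF assms] by algebra
  then show ?thesis unfolding m by (simp add: algebra_simps)
qed

lemma e_coeff_recurrence:
  assumes "n \<ge> 1"
  shows "e_coeff (n + 2) k =
    (if k < 1 then 0 else 3 * e_coeff (n + 1) (k - 1)) +
    (if k < 3 then 0 else 3 * e_coeff (n + 1) (k - 3)) -
    (if k < 4 then 0 else 8 * e_coeff n (k - 4))"
  unfolding e_coeff_def Q2_poly_recurrence[OF assms] by (simp add: coeff_monom_mult)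

lemma S_poly_0: "S_poly 0 w x y z = 1"
  by (simp add: S_poly_eq S_factor_def)

lemma S_poly_3: "S_poly 3 w x y z = w + x + y + (w + x) * z + w * x * (y :: 'a :: idom)"
proof -
  have "S_poly 1 w x y z = w + x + y"
    using fps_nth_mult_S_factor[of 1 1 "S_factor w x y z 0" w x y z]
      fps_nth_S_factor_0_mult[of w x y z 1 1]
    by (simp add: S_poly_eq)
  then show ?thesis
    using S_poly_digit_0[of 0 w x y z] by (simp add: S_poly_0 add.assoc)
qed

lemma e_coeff_1: "e_coeff 1 k = (if k = 0 then 1 else 0)"
  by (auto simp: e_coeff_def Q2_poly_def Q_poly_def S_poly_0 coeff_1 split: nat.split)

lemma e_coeff_2: "e_coeff 2 k = (if k = 1 \<or> k = 3 then 3 else 0)"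
proof -
  have "Q2_poly 2 = monom 3 1 + monom 3 3"
    unfolding Q2_poly_def Q_poly_def
    by (simp add: S_poly_3 monom_altdef power2_eq_square power3_eq_cube algebra_simps)
  then show ?thesis by (simp add: e_coeff_def)
qed

lemma two_step_induct [consumes 1, case_names one two step]:
  assumes "n \<ge> 1" "P 1" "P 2" "\<And>n. n \<ge> 1 \<Longrightarrow> P n \<Longrightarrow> P (n + 1) \<Longrightarrow> P (n + 2)"
  shows "P (n :: nat)"
proof -
  have "P n \<and> P (n + 1)"
    using assms(1)
    by (induction n rule: dec_induct) (use assms in \<open>auto simp: numeral_2_eq_2\<close>)
  then show ?thesis ..
qed

text \<open>
  Each of the terms \<open>z Q\<^sub>n\<^sub>+\<^sub>1\<close>, \<open>z\<^sup>3 Q\<^sub>n\<^sub>+\<^sub>1\<close> and \<open>z\<^sup>4 Q\<^sub>n\<close> of the recurrence already obeys the bounds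
  and the parity required of \<open>Q\<^sub>n\<^sub>+\<^sub>2\<close>. Adding to \<open>k\<close> in the bounds avoids truncated subtraction.
\<close>

lemma e_coeff_support:
  assumes "n \<ge> 1"
  shows "\<forall>k. e_coeff n k \<noteq> 0 \<longrightarrow> n \<le> k + 1 \<and> k + 3 \<le> 3 * n \<and> odd (n + k)"
  using assms
proof (induction n rule: two_step_induct)
  case (step n)
  show ?case
  proof (intro allI impI)
    fix k assume "e_coeff (n + 2) k \<noteq> 0"
    then have "k \<ge> 1 \<and> e_coeff (n + 1) (k - 1) \<noteq> 0 \<or> k \<ge> 3 \<and> e_coeff (n + 1) (k - 3) \<noteq> 0
        \<or> k \<ge> 4 \<and> e_coeff n (k - 4) \<noteq> 0"
      unfolding e_coeff_recurrence[OF step(1)] by (rule contrapos_np) auto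
    then consider (one) "k \<ge> 1" "e_coeff (n + 1) (k - 1) \<noteq> 0"
      | (three) "k \<ge> 3" "e_coeff (n + 1) (k - 3) \<noteq> 0"
      | (four) "k \<ge> 4" "e_coeff n (k - 4) \<noteq> 0"
      by blast
    then show "n + 2 \<le> k + 1 \<and> k + 3 \<le> 3 * (n + 2) \<and> odd (n + 2 + k)"
    proof cases
      case one
      then show ?thesis using step(3)[rule_format, OF one(2)] by auto
    next
      case three
      then show ?thesis using step(3)[rule_format, OF three(2)] by auto
    next
      case four
      then show ?thesis using step(2)[rule_format, OF four(2)] by auto
    qed
  qed
qed (auto simp: e_coeff_1 e_coeff_1[simplified] e_coeff_2 split: if_splits)

text \<open>
  The lowest exponent of \<open>Q\<^sub>n\<^sub>+\<^sub>2\<close> is reached only by the term \<open>3 z Q\<^sub>n\<^sub>+\<^sub>1\<close>, so each step multiplies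
  the lowest coefficient by 3.
\<close>

lemma e_coeff_lowest:
  assumes "n \<ge> 1"
  shows "e_coeff n (n - 1) = 3 ^ (n - 1)"
  using assms
proof (induction n rule: two_step_induct)
  case (step n)
  have "e_coeff (n + 1) (n - 2) = 0" "e_coeff n (n - 3) = 0 \<or> n < 3"
    using e_coeff_support[of "n + 1"] e_coeff_support[of n] step(1) by force+
  then have "e_coeff (n + 2) (n + 1) = 3 * e_coeff (n + 1) n"
    unfolding e_coeff_recurrence[OF step(1)] by auto
  then show ?case using step(3) by simp
qed (auto simp: e_coeff_1 e_coeff_1[simplified] e_coeff_2)

text \<open>
  The reflection exchanges the contributions of \<open>3 z Q\<^sub>n\<^sub>+\<^sub>1\<close> and \<open>3 z\<^sup>3 Q\<^sub>n\<^sub>+\<^sub>1\<close> to the coefficients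
  of \<open>Q\<^sub>n\<^sub>+\<^sub>2\<close> and fixes that of \<open>8 z\<^sup>4 Q\<^sub>n\<close>.
\<close>

lemma e_coeff_symmetric:
  assumes "n \<ge> 1"
  shows "\<forall>i k. i + k + 4 = 4 * n \<longrightarrow> e_coeff n i = e_coeff n k"
  using assms
proof (induction n rule: two_step_induct)
  case (step n)
  have z1: "e_coeff (Suc n) l = 0" if "l > 3 * n" for l
    using e_coeff_support[of "n + 1"] that by force
  have z0: "e_coeff n l = 0" if "l > 3 * n - 3" for l
    using e_coeff_support[of n] that step(1) by force
  define a where "a l = (if l < 1 then 0 else 3 * e_coeff (n + 1) (l - 1))" for l
  define b where "b l = (if l < 3 then 0 else 3 * e_coeff (n + 1) (l - 3))" for l
  define d where "d l = (if l < 4 then 0 else 8 * e_coeff n (l - 4))" for l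
  (* If one of the two contributions is 0 because its exponent would be negative, the other is 0
     because its exponent lies above the support; the same holds for dd below. *)
  have ab: "a i = b k" if "i + k = 4 * n + 4" for i k
  proof (cases "i \<ge> 1 \<and> k \<ge> 3")
    case True
    then have "e_coeff (n + 1) (i - 1) = e_coeff (n + 1) (k - 3)"
      using that by (intro step(3)[rule_format]) auto
    then show ?thesis using True by (simp add: a_def b_def)
  qed (use that step(1) in \<open>auto simp: a_def b_def z1\<close>)
  have dd: "d i = d k" if "i + k = 4 * n + 4" for i k
  proof (cases "i \<ge> 4 \<and> k \<ge> 4")
    case True
    then have "e_coeff n (i - 4) = e_coeff n (k - 4)"
      using that by (intro step(2)[rule_format]) auto
    then show ?thesis using True by (simp add: d_def)
  qed (use that step(1) in \<open>auto simp: d_def z0\<close>)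
  have e: "e_coeff (n + 2) l = a l + b l - d l" for l
    unfolding e_coeff_recurrence[OF step(1)] a_def b_def d_def ..
  show ?case
  proof (intro allI impI)
    fix i k assume "i + k + 4 = 4 * (n + 2)"
    then show "e_coeff (n + 2) i = e_coeff (n + 2) k"
      unfolding e using ab[of i k] ab[of k i] dd[of i k] by simp
  qed
qed (auto simp: e_coeff_1 e_coeff_1[simplified] e_coeff_2)

section \<open>Counting multisets with bounded multiplicities\<close>

definition bounded_multisets :: "'a set \<Rightarrow> ('a \<Rightarrow> nat) \<Rightarrow> 'a multiset set" where
  "bounded_multisets A b = {M. set_mset M \<subseteq> A \<and> (\<forall>a \<in> A. count M a \<le> b a)}"

text \<open>
  A multiset over \<open>insert a A\<close> splits uniquely into its part over \<open>A\<close> and the multiplicity of \<open>a\<close>.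
\<close>

lemma bij_betw_bounded_multisets_insert:
  assumes "a \<notin> A"
  shows "bij_betw (\<lambda>(M, i). M + replicate_mset i a)
    (bounded_multisets A b \<times> {..b a}) (bounded_multisets (insert a A) b)"
proof (rule bij_betw_byWitness[where f' = "\<lambda>M. (filter_mset (\<lambda>c. c \<noteq> a) M, count M a)"])
  show "\<forall>p \<in> bounded_multisets A b \<times> {..b a}.
      (\<lambda>M. (filter_mset (\<lambda>c. c \<noteq> a) M, count M a)) ((\<lambda>(M, i). M + replicate_mset i a) p) = p"
  proof
    fix p assume "p \<in> bounded_multisets A b \<times> {..b a}"
    then obtain M i where p: "p = (M, i)" and M: "M \<in> bounded_multisets A b" by blast
    have "a \<notin># M" using M assms unfolding bounded_multisets_def by blast
    then have "filter_mset (\<lambda>c. c \<noteq> a) (M + replicate_mset i a) = M"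
      and "count (M + replicate_mset i a) a = i"
      by (auto simp: multiset_eq_iff not_in_iff)
    then show "(\<lambda>M. (filter_mset (\<lambda>c. c \<noteq> a) M, count M a)) ((\<lambda>(M, i). M + replicate_mset i a) p) = p"
      unfolding p by simp
  qed
  show "\<forall>M \<in> bounded_multisets (insert a A) b.
      (\<lambda>(M, i). M + replicate_mset i a) (filter_mset (\<lambda>c. c \<noteq> a) M, count M a) = M"
    by (simp add: multiset_eq_iff)
  show "(\<lambda>(M, i). M + replicate_mset i a) ` (bounded_multisets A b \<times> {..b a})
      \<subseteq> bounded_multisets (insert a A) b"
  proof -
    have "M + replicate_mset i a \<in> bounded_multisets (insert a A) b"
      if M: "M \<in> bounded_multisets A b" and i: "i \<le> b a" for M i
    proof -
      have "count M a = 0"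
        using M assms unfolding bounded_multisets_def by (auto simp: not_in_iff)
      then show ?thesis
        using M i by (auto simp: bounded_multisets_def split: if_splits)
    qed
    then show ?thesis by auto
  qed
  show "(\<lambda>M. (filter_mset (\<lambda>c. c \<noteq> a) M, count M a)) ` bounded_multisets (insert a A) b
      \<subseteq> bounded_multisets A b \<times> {..b a}"
    by (auto simp: bounded_multisets_def)
qed

lemma finite_bounded_multisets:
  "finite A \<Longrightarrow> finite (bounded_multisets A b)"
proof (induction A rule: finite_induct)
  case empty
  show ?case by (simp add: bounded_multisets_def)
next
  case (insert a A)
  then show ?case
    using bij_betw_finite[OF bij_betw_bounded_multisets_insert[of a A b]] by simp
qed

text \<open>
  The product rule for generating functions: expanding the right-hand side means choosing a
  multiplicity for every element of \<open>A\<close> independently.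
\<close>

lemma sum_bounded_multisets:
  fixes f :: "'a \<Rightarrow> 'b :: comm_semiring_1"
  assumes "finite A"
  shows "(\<Sum>M \<in> bounded_multisets A b. \<Prod>a \<in># M. f a) = (\<Prod>a \<in> A. \<Sum>i \<le> b a. f a ^ i)"
  using assms
proof (induction A rule: finite_induct)
  case empty
  have "bounded_multisets {} b = {{#}}" by (auto simp: bounded_multisets_def)
  then show ?case by simp
next
  case (insert a A)
  have "(\<Sum>M \<in> bounded_multisets (insert a A) b. \<Prod>a \<in># M. f a) =
      (\<Sum>(M, i) \<in> bounded_multisets A b \<times> {..b a}. (\<Prod>a \<in># M. f a) * f a ^ i)"
    using sum.reindex_bij_betw[OF bij_betw_bounded_multisets_insert[OF insert(2), of b],
        of "\<lambda>M. \<Prod>a \<in># M. f a"]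
    by (simp add: case_prod_unfold)
  also have "\<dots> = (\<Sum>M \<in> bounded_multisets A b. \<Prod>a \<in># M. f a) * (\<Sum>i \<le> b a. f a ^ i)"
    by (simp add: sum_product sum.cartesian_product)
  finally show ?case using insert by (simp add: mult.commute)
qed

section \<open>Partitions as the terms of the product\<close>

definition mark_bound :: "mark \<Rightarrow> nat" where
  "mark_bound c = (if c = Unmarked then 2 else 1)"

lemma UNIV_mark: "UNIV = {Unmarked, Overlined, Tilde}"
  using mark.exhaust by auto

text \<open>
  A part \<open>3\<^sup>j\<close> of a partition of \<open>m\<close> has \<open>j < 3\<^sup>j \<le> m\<close>, so the powers up to \<open>3\<^sup>N\<close> suffice and the
  partitions live over a finite set of marked parts.
\<close>

lemma restricted_colored_partition_iff_bounded:
  assumes "m \<le> N"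
  shows "restricted_colored_partition m P \<longleftrightarrow>
    P \<in> bounded_multisets ((\<lambda>j. 3 ^ j) ` {..N} \<times> UNIV) (\<lambda>(p, c). mark_bound c) \<and>
    (\<Sum>(p, c) \<in># P. p) = m"
    (is "?L \<longleftrightarrow> ?R" is "_ \<longleftrightarrow> P \<in> bounded_multisets ?A ?b \<and> _")
proof
  assume L: ?L
  have part: "p \<in> (\<lambda>j. 3 ^ j) ` {..N}" if pc: "(p, c) \<in># P" for p c
  proof -
    obtain j where j: "p = 3 ^ j"
      using L pc unfolding restricted_colored_partition_def by fast
    have "p \<le> (\<Sum>(p, c) \<in># P. p)"
      using pc by (auto dest!: multi_member_split)
    moreover have "j < 3 ^ j" by (induction j) auto
    ultimately have "j \<le> N" using L assms j by (simp add: restricted_colored_partition_def)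
    then show ?thesis using j by simp
  qed
  have mult: "count P (3 ^ j, c) \<le> mark_bound c" for j c
    using L by (cases c) (simp_all add: restricted_colored_partition_def mark_bound_def)
  have "P \<in> bounded_multisets ?A ?b"
    using part mult unfolding bounded_multisets_def by auto
  then show ?R
    using L by (simp add: restricted_colored_partition_def)
next
  assume R: ?R
  have part: "\<exists>j. p = 3 ^ j" if "(p, c) \<in># P" for p c
    using R that unfolding bounded_multisets_def by blast
  have mult: "count P (3 ^ j, c) \<le> mark_bound c" for j c
  proof (cases "(3 ^ j, c) \<in># P")
    case True
    then have "(3 ^ j, c) \<in> ?A" using R unfolding bounded_multisets_def by blast
    then have "count P (3 ^ j, c) \<le> ?b (3 ^ j, c)"
      using R unfolding bounded_multisets_def by blast
    then show ?thesis by simp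
  qed (simp add: not_in_iff)
  show ?L
    unfolding restricted_colored_partition_def
    using R part mult[of _ Overlined] mult[of _ Tilde] mult[of _ Unmarked]
    by (auto simp: mark_bound_def)
qed

text \<open>
  Giving the marked part \<open>p\<close> the weight \<open>u q\<^sup>p\<close> makes the weight of a multiset record its size and
  its sum at the same time.
\<close>

lemma prod_mset_part_weight:
  "(\<Prod>(p, c) \<in># P. fps_const u * fps_X ^ p) =
    fps_const (u ^ size P) * (fps_X :: 'a :: comm_ring_1 fps) ^ (\<Sum>(p, c) \<in># P. p)"
  by (induction P) (auto simp: power_add algebra_simps simp flip: fps_const_mult)

lemma S_factor_eq_prod_marks:
  "S_factor u u u (u\<^sup>2) j = (\<Prod>c \<in> UNIV. \<Sum>i \<le> mark_bound c. (fps_const u * fps_X ^ (3 ^ j)) ^ i)"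
proof -
  define r where "r = fps_const u * fps_X ^ (3 ^ j)"
  have "S_factor u u u (u\<^sup>2) j = (1 + r) * (1 + r) * (1 + r + r\<^sup>2)"
    by (simp add: S_factor_def r_def power_mult_distrib mult.commute flip: power_mult)
  also have "\<dots> = (\<Prod>c \<in> UNIV. \<Sum>i \<le> mark_bound c. r ^ i)"
    by (simp add: UNIV_mark mark_bound_def numeral_2_eq_2 ac_simps)
  finally show ?thesis unfolding r_def .
qed

text \<open>
  The refined count of restricted partitions by number of parts, over any commutative ring: the
  truncated product is the sum of the weights of all bounded multisets, and taking the coefficient
  at \<open>m\<close> selects those with sum \<open>m\<close>.
\<close>

lemma S_poly_eq_sum_partitions:
  "S_poly m u u u (u\<^sup>2) = (\<Sum>P | restricted_colored_partition m P. u ^ size P)"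
proof -
  let ?A = "(\<lambda>j. 3 ^ j :: nat) ` {..m} \<times> (UNIV :: mark set)"
  let ?B = "bounded_multisets ?A (\<lambda>(p, c). mark_bound c)"
  let ?f = "\<lambda>(p, c). fps_const u * fps_X ^ p"
  have fin: "finite ?A" by (simp add: UNIV_mark)
  have "(\<Prod>j\<le>m. S_factor u u u (u\<^sup>2) j) = (\<Prod>p \<in> (\<lambda>j. 3 ^ j) ` {..m}. \<Prod>c \<in> UNIV.
      \<Sum>i \<le> mark_bound c. (fps_const u * fps_X ^ p) ^ i)"
    by (subst prod.reindex) (auto simp: S_factor_eq_prod_marks inj_on_def)
  also have "\<dots> = (\<Prod>a \<in> ?A. \<Sum>i \<le> (\<lambda>(p, c). mark_bound c) a. ?f a ^ i)"
    by (simp add: prod.cartesian_product case_prod_unfold)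
  also have "\<dots> = (\<Sum>P \<in> ?B. \<Prod>a \<in># P. ?f a)"
    by (rule sum_bounded_multisets[OF fin, symmetric])
  also have "fps_nth \<dots> m = (\<Sum>P \<in> ?B. if (\<Sum>(p, c) \<in># P. p) = m then u ^ size P else 0)"
    by (auto simp: fps_sum_nth prod_mset_part_weight intro!: sum.cong)
  also have "\<dots> = (\<Sum>P | P \<in> ?B \<and> (\<Sum>(p, c) \<in># P. p) = m. u ^ size P)"
    by (subst sum.inter_filter) (simp_all add: finite_bounded_multisets[OF fin])
  finally show ?thesis
    by (simp add: S_poly_eq restricted_colored_partition_iff_bounded[OF order.refl])
qed

lemma e_coeff_eq_card:
  "e_coeff n k = int (card {P. restricted_colored_partition ((3 ^ n - 3) div 2) P \<and> size P = k})"
proof -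
  let ?R = "restricted_colored_partition ((3 ^ n - 3) div 2)"
  have "e_coeff n k = (\<Sum>P | ?R P. coeff ([:0, 1:] ^ size P) k)"
    by (simp add: e_coeff_def Q2_poly_def Q_poly_def S_poly_eq_sum_partitions coeff_sum)
  also have "\<dots> = (\<Sum>P | ?R P. if size P = k then 1 else 0)"
    by (simp flip: monom_altdef[of 1, simplified])
  also have "\<dots> = (\<Sum>P | P \<in> Collect ?R \<and> size P = k. 1)"
    by (subst sum.inter_filter) (simp_all add: finite_restricted_colored_partitions)
  finally show ?thesis by simp
qed

theorem proposition5p2:
  fixes n :: nat
  assumes "n \<ge> 1"
  shows "Q2_poly n = (\<Sum>k = n - 1..3 * n - 3. monom (e_coeff n k) k) \<and>
    (\<forall>k. e_coeff n k = int (card {P. restricted_colored_partition ((3 ^ n - 3) div 2) P \<and> size P = k})) \<and>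
    (\<forall>P. restricted_colored_partition ((3 ^ n - 3) div 2) P \<longrightarrow>
       n - 1 \<le> size P \<and> size P \<le> 3 * n - 3) \<and>
    (\<forall>P. restricted_colored_partition ((3 ^ n - 3) div 2) P \<longrightarrow> even (size P) \<noteq> even n) \<and>
    (\<forall>j \<le> (n - 1) div 2.
       card {P. restricted_colored_partition ((3 ^ n - 3) div 2) P \<and> size P = n - 1 + j} =
       card {P. restricted_colored_partition ((3 ^ n - 3) div 2) P \<and> size P = 3 * n - 3 - j}) \<and>
    card {P. restricted_colored_partition ((3 ^ n - 3) div 2) P \<and> size P = n - 1} = 3 ^ (n - 1)"
proof -
  let ?R = "restricted_colored_partition ((3 ^ n - 3) div 2)"
  have supp: "n \<le> k + 1 \<and> k + 3 \<le> 3 * n \<and> odd (n + k)" if "e_coeff n k \<noteq> 0" for k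
    using e_coeff_support[OF assms] that by blast
  have "coeff (Q2_poly n) k = coeff (\<Sum>k = n - 1..3 * n - 3. monom (e_coeff n k) k) k" for k
    using supp[of k] by (cases "e_coeff n k = 0") (auto simp: coeff_sum sum.delta simp flip: e_coeff_def)
  then have expansion: "Q2_poly n = (\<Sum>k = n - 1..3 * n - 3. monom (e_coeff n k) k)"
    by (rule poly_eqI)
  have nonzero: "e_coeff n (size P) \<noteq> 0" if "?R P" for P
  proof -
    have "finite {P'. ?R P' \<and> size P' = size P}"
      by (rule finite_subset[OF _ finite_restricted_colored_partitions]) auto
    then show ?thesis using that by (auto simp: e_coeff_eq_card)
  qed
  have symmetric: "card {P. ?R P \<and> size P = n - 1 + j} = card {P. ?R P \<and> size P = 3 * n - 3 - j}"
    if "j \<le> (n - 1) div 2" for j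
  proof -
    have "e_coeff n (n - 1 + j) = e_coeff n (3 * n - 3 - j)"
      using that assms by (intro e_coeff_symmetric[OF assms, rule_format]) auto
    then show ?thesis by (simp add: e_coeff_eq_card)
  qed
  have "int (card {P. ?R P \<and> size P = n - 1}) = int (3 ^ (n - 1))"
    using e_coeff_lowest[OF assms] by (simp add: e_coeff_eq_card)
  then have lowest: "card {P. ?R P \<and> size P = n - 1} = 3 ^ (n - 1)"
    by (simp only: of_nat_eq_iff)
  have range: "n - 1 \<le> size P \<and> size P \<le> 3 * n - 3" "even (size P) \<noteq> even n" if "?R P" for P
    using supp[OF nonzero[OF that]] by auto
  show ?thesis
    using expansion e_coeff_eq_card range symmetric lowest by blast
qed

end
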